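(* Let $f:\mathbb{C}\to\mathbb{C}$ be a complex polynomial of degree at least $2$, let $\mathcal{P}$ be a puzzle of $f$ with its tree with dynamics $(\mathsf{T}(\mathcal{P}),\mathsf{F}_f)$, let $(P_l)_{l\in\mathbb{Z}}$ be an extended nest of puzzle pieces of $\mathcal{P}$, and let $(P_{l(k)})_{k\in\mathbb{Z}}$ be a return nest of $(P_l)_{l\in\mathbb{Z}}$ with return times $(n_k)_{k\in\mathbb{Z}}$. Then $(n_k)_{k\in\mathbb{Z}}$ is an extended variable-$r$ meta-Fibonacci sequence; that is, there is a function $r:\mathbb{Z}\to\mathbb{Z}^+$ such that $$n_k=\sum_{j=1}^{r(k)} n_{k-j}\qquad\text{for all }k\in\mathbb{Z}.$$
   Context: $\mathcal{K}(f)$ denotes the filled Julia set of $f$ (the set of points with bounded orbit under $f$). Puzzle. A puzzle of $f$ is a sequence $\mathcal{P}=(\mathcal{P}_l)_{l\in\mathbb{Z}}$, where each $\mathcal{P}_l$ is an at most countable collection of pairwise disjoint non-empty subsets of $\mathbb{C}$ such that $\mathcal{K}(f)\subset\bigcup_{P\in\mathcal{P}_l}\overline{P}$ for each $l\in\mathbb{Z}$. Each $P\in\mathcal{P}_l$ is a puzzle piece at depth $l$. The following Markov properties are required: (1) for any puzzle pieces $P_1,P_2$ there is a puzzle piece $P$ with $P_1\cup P_2\subset P$; (2) if $P\in\mathcal{P}_l$ then $P\subsetneq P^{\mathsf p}$ for some (unique) $P^{\mathsf p}\in\mathcal{P}_{l-1}$, called the parent of $P$; (3) if $P\in\mathcal{P}_l$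 then $f(P)=Q$ and $f(P^{\mathsf p})=Q^{\mathsf p}$ for some $Q\in\mathcal{P}_L$ with $L<l$. Finitely many puzzle pieces are allowed to have exceptional dynamics, meaning that instead of (3) they satisfy only: (3') if $P\in\mathcal{P}_l$ then $f(P)\subset Q\subset f(P^{\mathsf p})$ for some $Q\in\mathcal{P}_L$ with $L<l$. The ancestors of $P$ are $P, P^{\mathsf p}, (P^{\mathsf p})^{\mathsf p},\dots$. It is assumed that every piece with exceptional dynamics has an ancestor with non-exceptional dynamics. Tree with dynamics of a puzzle. $\mathsf{T}(\mathcal{P})$ is the tree whose vertices are the puzzle pieces, each joined by an edge to its parent; $Q$ is a child of $P$ if $Q^{\mathsf p}=P$. The induced dynamics $\mathsf{F}_f:\mathsf{T}(\mathcal{P})\to\mathsf{T}(\mathcal{P})$ is defined by $\mathsf{F}_f(P)=f(P)$ if $P$ has non-exceptional dynamics; if $P$ has exceptional dynamics, then inductively $\mathsf{F}_f(P)=Q$, where $Q$ is the unique puzzle piece with $f(P)\subset Q$ and $Q^{\mathsf p}=\mathsf{F}_f(P^{\mathsf p})$. It is part of the setting that $\mathsf{F}_f$ is well defined and that $(\mathsf{T}(\mathcal{P}),\mathsf{F}_f)$ is a tree with dynamics, i.e. $\mathsf{F}_f$ preserves children: $\mathsf{F}_f(P^{\mathsf p})=\mathsf{F}_f(P)^{\mathsf p}$ for all puzzle pieces $P$. Nests and returns. An extended nest of puzzle pieces is a sequence $(P_l)_{l\in\mathbb{Z}}$ with $P_l\in\mathcal{P}_l$ and $P_l=P_{l+1}^{\mathsf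 p}$ for all $l$. The first return time of $P_l$ is the least $n\ge1$ such that $\mathsf{F}_f^n(P_l)=P_m$ for some $m\in\mathbb{Z}$ (if it exists), and then $P_m$ is the first return of $P_l$. A return nest of $(P_l)$ is a sub-nest $(P_{l(k)})_{k\in\mathbb{Z}}$ such that $\mathsf{F}_f^{n_k}(P_{l(k)})=P_{l(k-1)}$ for all $k\in\mathbb{Z}$, where $n_k$ is the first return time of $P_{l(k)}$; $(n_k)_{k\in\mathbb{Z}}$ are its return times. *)

theory Defs
  imports
    "HOL-Analysis.Analysis"
    "HOL-Computational_Algebra.Polynomial"
begin

definition filled_julia_set :: "(complex \<Rightarrow> complex) \<Rightarrow> complex set" where
  "filled_julia_set f = {z. bounded (range (\<lambda>n. (f ^^ n) z))}"

definition pieces :: "(int \<Rightarrow> complex set set) \<Rightarrow> complex set set" where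
  "pieces \<P> = (\<Union>l. \<P> l)"

text \<open>
  In a puzzle (defined below) no set is a piece at two different depths: if it were, it would meet
  its strictly larger ancestor at the smaller depth, against disjointness. So the depth \<open>l\<close> in the
  following definitions is determined by \<open>P\<close>, and pieces can be represented as plain sets.
\<close>

definition parent :: "(int \<Rightarrow> complex set set) \<Rightarrow> complex set \<Rightarrow> complex set" where
  "parent \<P> P = (THE Q. \<exists>l. P \<in> \<P> l \<and> Q \<in> \<P> (l - 1) \<and> P \<subset> Q)"

definition regular_dynamics ::
  "(complex \<Rightarrow> complex) \<Rightarrow> (int \<Rightarrow> complex set set) \<Rightarrow> complex set \<Rightarrow> bool" where
  "regular_dynamics f \<P> P \<longleftrightarrow>
     (\<exists>l L Q. P \<in> \<P> l \<and> L < l \<and> Q \<in> \<P> L \<and> f ` P = Q \<and> f ` parent \<P> P = parent \<P> Q)"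

definition weak_dynamics ::
  "(complex \<Rightarrow> complex) \<Rightarrow> (int \<Rightarrow> complex set set) \<Rightarrow> complex set \<Rightarrow> bool" where
  "weak_dynamics f \<P> P \<longleftrightarrow>
     (\<exists>l L Q. P \<in> \<P> l \<and> L < l \<and> Q \<in> \<P> L \<and> f ` P \<subseteq> Q \<and> Q \<subseteq> f ` parent \<P> P)"

definition exceptional_pieces ::
  "(complex \<Rightarrow> complex) \<Rightarrow> (int \<Rightarrow> complex set set) \<Rightarrow> complex set set" where
  "exceptional_pieces f \<P> = {P \<in> pieces \<P>. \<not> regular_dynamics f \<P> P}"

definition puzzle :: "(complex \<Rightarrow> complex) \<Rightarrow> (int \<Rightarrow> complex set set) \<Rightarrow> bool" where
  "puzzle f \<P> \<longleftrightarrow>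
     (\<forall>l. countable (\<P> l) \<and> {} \<notin> \<P> l \<and> pairwise disjnt (\<P> l) \<and>
          filled_julia_set f \<subseteq> (\<Union>P\<in>\<P> l. closure P)) \<and>
     (\<forall>P1\<in>pieces \<P>. \<forall>P2\<in>pieces \<P>. \<exists>P\<in>pieces \<P>. P1 \<union> P2 \<subseteq> P) \<and>
     (\<forall>l. \<forall>P\<in>\<P> l. \<exists>!Q. Q \<in> \<P> (l - 1) \<and> P \<subset> Q) \<and>
     finite (exceptional_pieces f \<P>) \<and>
     (\<forall>P\<in>exceptional_pieces f \<P>. weak_dynamics f \<P> P) \<and>
     (\<forall>P\<in>exceptional_pieces f \<P>. \<exists>i. (parent \<P> ^^ i) P \<notin> exceptional_pieces f \<P>)"

text \<open>
  The graph of the induced dynamics on the tree of puzzle pieces; the recursion runs through the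
  ancestors of an exceptional piece up to the first non-exceptional one.
\<close>

inductive induced_graph ::
  "(complex \<Rightarrow> complex) \<Rightarrow> (int \<Rightarrow> complex set set) \<Rightarrow> complex set \<Rightarrow> complex set \<Rightarrow> bool"
  for f \<P> where
  regular: "P \<in> pieces \<P> \<Longrightarrow> P \<notin> exceptional_pieces f \<P> \<Longrightarrow> induced_graph f \<P> P (f ` P)"
| exceptional: "P \<in> exceptional_pieces f \<P> \<Longrightarrow> induced_graph f \<P> (parent \<P> P) R \<Longrightarrow>
    Q \<in> pieces \<P> \<Longrightarrow> f ` P \<subseteq> Q \<Longrightarrow> parent \<P> Q = R \<Longrightarrow> induced_graph f \<P> P Q"

definition induced_well_defined ::
  "(complex \<Rightarrow> complex) \<Rightarrow> (int \<Rightarrow> complex set set) \<Rightarrow> bool" where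
  "induced_well_defined f \<P> \<longleftrightarrow> (\<forall>P\<in>pieces \<P>. \<exists>!Q. induced_graph f \<P> P Q)"

definition induced_dynamics ::
  "(complex \<Rightarrow> complex) \<Rightarrow> (int \<Rightarrow> complex set set) \<Rightarrow> complex set \<Rightarrow> complex set" where
  "induced_dynamics f \<P> P = (THE Q. induced_graph f \<P> P Q)"

text \<open>The tree of a puzzle is encoded by its vertex set \<open>pieces \<P>\<close> and its parent map.\<close>

definition tree_with_dynamics ::
  "(int \<Rightarrow> complex set set) \<Rightarrow> (complex set \<Rightarrow> complex set) \<Rightarrow> bool" where
  "tree_with_dynamics \<P> F \<longleftrightarrow>
     (\<forall>P\<in>pieces \<P>. F P \<in> pieces \<P> \<and> F (parent \<P> P) = parent \<P> (F P))"

definition extended_nest ::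
  "(int \<Rightarrow> complex set set) \<Rightarrow> (int \<Rightarrow> complex set) \<Rightarrow> bool" where
  "extended_nest \<P> N \<longleftrightarrow> (\<forall>l. N l \<in> \<P> l \<and> N l = parent \<P> (N (l + 1)))"

definition is_first_return_time ::
  "(complex set \<Rightarrow> complex set) \<Rightarrow> (int \<Rightarrow> complex set) \<Rightarrow> int \<Rightarrow> nat \<Rightarrow> bool" where
  "is_first_return_time F N l n \<longleftrightarrow>
     n \<ge> 1 \<and> (\<exists>m. (F ^^ n) (N l) = N m) \<and>
     (\<forall>i. 1 \<le> i \<and> i < n \<longrightarrow> \<not> (\<exists>m. (F ^^ i) (N l) = N m))"

definition return_nest ::
  "(complex set \<Rightarrow> complex set) \<Rightarrow> (int \<Rightarrow> complex set) \<Rightarrow> (int \<Rightarrow> int) \<Rightarrow> (int \<Rightarrow> nat) \<Rightarrow> bool" where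
  "return_nest F N l n \<longleftrightarrow> strict_mono l \<and>
     (\<forall>k. is_first_return_time F N (l k) (n k) \<and> (F ^^ n k) (N (l k)) = N (l (k - 1)))"

definition extended_meta_fibonacci :: "(int \<Rightarrow> nat) \<Rightarrow> bool" where
  "extended_meta_fibonacci n \<longleftrightarrow>
     (\<exists>r :: int \<Rightarrow> int. (\<forall>k. r k > 0) \<and> (\<forall>k. n k = (\<Sum>j = 1..r k. n (k - j))))"

end

theory Submission imports Defs begin

text \<open>
  Since the dynamics commutes with the parent map, the first return of \<open>N (l k)\<close> to \<open>N (l (k - 1))\<close>
  at time \<open>n k\<close> also carries the coarser piece \<open>N (l (k - 1))\<close> back into the nest. But the orbit of
  \<open>N (l (k - 1))\<close> meets the nest only at \<open>N (l (k - 2))\<close>, \<open>N (l (k - 3))\<close>, \<open>\<dots>\<close>, that is, at the times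
  \<open>n (k - 1)\<close>, \<open>n (k - 1) + n (k - 2)\<close>, \<open>\<dots>\<close>, so \<open>n k\<close> is one of these partial sums.
\<close>

lemma tree_with_dynamics_funpow:
  assumes "tree_with_dynamics \<P> F" and "P \<in> pieces \<P>"
  shows "(F ^^ m) P \<in> pieces \<P>" and "(F ^^ m) (parent \<P> P) = parent \<P> ((F ^^ m) P)"
proof (induction m)
  case (Suc m)
  case 1
  then show ?case
    using assms(1) Suc(1) by (simp add: tree_with_dynamics_def)
  case 2
  have "F (parent \<P> ((F ^^ m) P)) = parent \<P> (F ((F ^^ m) P))"
    using assms(1) Suc(1) unfolding tree_with_dynamics_def by blast
  then show ?case
    by (simp only: funpow.simps o_apply Suc(2))
qed (simp_all add: assms(2))

text \<open>Iterates of \<open>F\<close> commute with \<open>parent\<close>, so a return at time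
  \<open>m\<close>, first or not, passes to all ancestors with the same index shift.\<close>

lemma extended_nest_return_ancestor:
  assumes "tree_with_dynamics \<P> F" and nest: "extended_nest \<P> N"
    and ret: "(F ^^ m) (N a) = N q"
  shows "(F ^^ m) (N (a - int i)) = N (q - int i)"
proof (induction i)
  case (Suc i)
  have parent: "N (b - int (Suc i)) = parent \<P> (N (b - int i))" for b
  proof -
    have "b - int (Suc i) + 1 = b - int i"
      by simp
    moreover have "N c = parent \<P> (N (c + 1))" for c
      using nest[unfolded extended_nest_def, THEN spec] by (rule conjunct2)
    ultimately show ?thesis
      by (rule subst)
  qed
  have "N (a - int i) \<in> pieces \<P>"
    using nest unfolding extended_nest_def pieces_def by blast
  then show ?case
    unfolding parent Suc[symmetric] by (rule tree_with_dynamics_funpow(2)[OF assms(1)])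
qed (simp add: ret)

text \<open>Strong induction on \<open>m\<close> splits off one first return at a time;
  \<open>k\<close> varies because the remaining time starts one step further along the return
  nest.\<close>

lemma return_time_eq_sum:
  assumes nest: "return_nest F N l n"
    and "m \<ge> 1" and "(F ^^ m) (N (l (k - 1))) = N q"
  shows "\<exists>r>0. m = (\<Sum>j = 1..r. n (k - j))"
  using assms(2,3)
proof (induction m arbitrary: k rule: less_induct)
  case (less m)
  have first: "n (k - 1) \<ge> 1"
      "\<And>i. 1 \<le> i \<Longrightarrow> i < n (k - 1) \<Longrightarrow> \<nexists>q. (F ^^ i) (N (l (k - 1))) = N q"
    and step: "(F ^^ n (k - 1)) (N (l (k - 1))) = N (l (k - 1 - 1))"
    using nest unfolding return_nest_def is_first_return_time_def by blast+
  show ?case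
  proof (cases "m = n (k - 1)")
    case True
    then show ?thesis by (intro exI[of _ 1]) simp
  next
    case False
    define m' where "m' = m - n (k - 1)"
    \<comment> \<open>Minimality of the first return time excludes
      \<open>m < n (k - 1)\<close>.\<close>
    have "n (k - 1) < m"
      using False first(2)[of m] less.prems by force
    \<comment> \<open>In this order \<open>funpow_add\<close> applies the first return before the
      other \<open>m'\<close> iterates.\<close>
    then have m: "m = m' + n (k - 1)" and m': "m' < m" "m' \<ge> 1"
      using first(1) by (auto simp: m'_def)
    have "(F ^^ m') (N (l (k - 1 - 1))) = N q"
      using less.prems(2) unfolding m funpow_add o_apply step .
    then obtain r where r: "r > 0" "m' = (\<Sum>j = 1..r. n (k - 1 - j))"
      using less.IH[OF m'] by blast
    \<comment> \<open>Shifting the index frees \<open>j = 1\<close> for the term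
      \<open>n (k - 1)\<close>.\<close>
    have "(\<Sum>j = 1..r. n (k - 1 - j)) = (\<Sum>j = 2..r + 1. n (k - j))"
      by (rule sum.reindex_bij_witness[of _ "\<lambda>j. j - 1" "\<lambda>j. j + 1"]) (auto simp: algebra_simps)
    moreover have "{1..r + 1} = insert 1 {2..r + 1}"
      using r(1) by auto
    ultimately have "m = (\<Sum>j = 1..r + 1. n (k - j))"
      using m r(2) by simp
    then show ?thesis
      using r(1) by (intro exI[of _ "r + 1"]) simp
  qed
qed

theorem theorem1p2:
  fixes p :: "complex poly" and f :: "complex \<Rightarrow> complex"
    and \<P> :: "int \<Rightarrow> complex set set" and N :: "int \<Rightarrow> complex set"
    and l :: "int \<Rightarrow> int" and n :: "int \<Rightarrow> nat"
  assumes "f = poly p" and "degree p \<ge> 2"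
    and "puzzle f \<P>"
    and "induced_well_defined f \<P>"
    and "tree_with_dynamics \<P> (induced_dynamics f \<P>)"
    and "extended_nest \<P> N"
    and "return_nest (induced_dynamics f \<P>) N l n"
  shows "extended_meta_fibonacci n"
proof -
  let ?F = "induced_dynamics f \<P>"
  have "\<exists>r>0. n k = (\<Sum>j = 1..r. n (k - j))" for k
  proof -
    have ret: "n k \<ge> 1" "(?F ^^ n k) (N (l k)) = N (l (k - 1))" and "l (k - 1) < l k"
      using assms(7) by (auto simp: return_nest_def is_first_return_time_def strict_mono_def)
    \<comment> \<open>As \<open>l\<close> increases, \<open>N (l (k - 1))\<close> is an ancestor of
      \<open>N (l k)\<close>, a natural number of generations up.\<close>
    then have "l (k - 1) = l k - int (nat (l k - l (k - 1)))"
      by simp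
    then obtain q where "(?F ^^ n k) (N (l (k - 1))) = N q"
      using extended_nest_return_ancestor[OF assms(5,6) ret(2)] by metis
    then show ?thesis
      using return_time_eq_sum[OF assms(7) ret(1)] by blast
  qed
  then show ?thesis
    unfolding extended_meta_fibonacci_def by metis
qed

end
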